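(* For $m\ge 3$ and $n\ge 3$, writing $n=3k$, $3k+1$ or $3k+2$ with $k$ a positive integer, $$\gamma(P_n\times K_m)= \begin{cases} 2k+1, & n=3k;\\ 2k+2, & n=3k+1 \text{ or } n=3k+2.\end{cases}$$
   Context: $P_n$ is the path on $\{1,\dots,n\}$ with edges $\{i,i+1\}$, $1\le i\le n-1$; $K_m$ is the complete graph on $\{1,\dots,m\}$. The direct product $G\times H$ has vertex set $V(G)\times V(H)$ with $(g_1,h_1)\sim(g_2,h_2)$ iff $g_1g_2\in E(G)$ and $h_1h_2\in E(H)$. $\gamma(G)$ denotes the domination number: the minimum size of a set $D$ of vertices such that every vertex not in $D$ is adjacent to a vertex of $D$. *)

theory Defs
  imports Main
begin

record 'a ugraph =
  verts :: "'a set"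
  edges :: "'a set set"

definition simple_graph :: "'a ugraph \<Rightarrow> bool" where
  "simple_graph G \<longleftrightarrow> (\<forall>e\<in>edges G. e \<subseteq> verts G \<and> card e = 2)"

definition adjacent :: "'a ugraph \<Rightarrow> 'a \<Rightarrow> 'a \<Rightarrow> bool" where
  "adjacent G u v \<longleftrightarrow> {u, v} \<in> edges G"

definition path_graph :: "nat \<Rightarrow> nat ugraph" where
  "path_graph n = \<lparr>verts = {1..n}, edges = {{i, i + 1} | i. 1 \<le> i \<and> i < n}\<rparr>"

definition complete_graph :: "nat \<Rightarrow> nat ugraph" where
  "complete_graph m = \<lparr>verts = {1..m}, edges = {e. e \<subseteq> {1..m} \<and> card e = 2}\<rparr>"

definition direct_product :: "'a ugraph \<Rightarrow> 'b ugraph \<Rightarrow> ('a \<times> 'b) ugraph" where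
  "direct_product G H =
     \<lparr>verts = verts G \<times> verts H,
      edges = {{(g1, h1), (g2, h2)} | g1 h1 g2 h2. adjacent G g1 g2 \<and> adjacent H h1 h2}\<rparr>"

definition dominating_set :: "'a ugraph \<Rightarrow> 'a set \<Rightarrow> bool" where
  "dominating_set G D \<longleftrightarrow>
     D \<subseteq> verts G \<and> (\<forall>v\<in>verts G - D. \<exists>u\<in>D. adjacent G v u)"

text \<open>Finiteness of the set is required because the cardinality of an infinite set is 0.\<close>

definition domination_number :: "'a ugraph \<Rightarrow> nat" where
  "domination_number G = (LEAST k. \<exists>D. dominating_set G D \<and> finite D \<and> card D = k)"

lemma adjacent_sym: "adjacent G u v \<longleftrightarrow> adjacent G v u"
  by (simp add: adjacent_def insert_commute)

lemma adjacent_direct_product: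
  "adjacent (direct_product G H) (g1, h1) (g2, h2) \<longleftrightarrow> adjacent G g1 g2 \<and> adjacent H h1 h2"
proof
  assume "adjacent (direct_product G H) (g1, h1) (g2, h2)"
  then show "adjacent G g1 g2 \<and> adjacent H h1 h2"
    by (auto simp: adjacent_def direct_product_def doubleton_eq_iff insert_commute)
next
  assume "adjacent G g1 g2 \<and> adjacent H h1 h2"
  then show "adjacent (direct_product G H) (g1, h1) (g2, h2)"
    by (subst adjacent_def, simp add: direct_product_def) blast
qed

lemma adjacent_path_graph:
  "adjacent (path_graph n) i j \<longleftrightarrow> i \<in> {1..n} \<and> j \<in> {1..n} \<and> (j = i + 1 \<or> i = j + 1)"
  by (auto simp: adjacent_def path_graph_def doubleton_eq_iff)

lemma adjacent_complete_graph:
  "adjacent (complete_graph m) i j \<longleftrightarrow> i \<in> {1..m} \<and> j \<in> {1..m} \<and> i \<noteq> j"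
  by (auto simp: adjacent_def complete_graph_def card_insert_if)

lemma simple_path_graph: "simple_graph (path_graph n)"
  by (auto simp: simple_graph_def path_graph_def)

lemma simple_complete_graph: "simple_graph (complete_graph m)"
  by (auto simp: simple_graph_def complete_graph_def)

lemma simple_direct_product:
  assumes "simple_graph G" and "simple_graph H"
  shows "simple_graph (direct_product G H)"
  using assms
  by (fastforce simp: simple_graph_def direct_product_def adjacent_def card_insert_if)

end

theory Submission
  imports Defs
begin

text \<open>
  Write \<open>a i\<close> for the number of vertices of a dominating set in the layer \<open>i\<close> of
  \<open>P\<^sub>n \<times> K\<^sub>m\<close>. A vertex \<open>(i, h)\<close> misses a neighbouring vertex \<open>(i \<plusminus> 1, c)\<close> only if \<open>h = c\<close>, so
  \<open>a (i - 1) + a i + a (i + 1) \<ge> 2\<close> for every layer, with \<open>a 0 = a (n + 1) = 0\<close>. Covering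
  \<open>0, \<dots>, n + 1\<close> by disjoint triples gives the lower bound unless \<open>n = 3k\<close>. If \<open>n = 3k\<close> and the
  total is at most \<open>2k\<close>, the possible coverings force \<open>a 1 = a 3 = 0\<close>; then layer \<open>2\<close> has no
  neighbours in the set, so all its \<open>m \<ge> 3\<close> vertices are in it, which is too many.
  The bound is attained by single vertices in the layers \<open>3j + 1\<close> and \<open>3j + 2\<close>, with
  equal second coordinates within a pair and distinct ones in consecutive pairs, adjusted at the
  right end.
\<close>

section \<open>Arithmetic of layer sizes\<close>

lemma sum_triples_ge:
  fixes a :: "nat \<Rightarrow> nat"
  assumes "\<And>j. j < k \<Longrightarrow> 2 \<le> a (s + 3*j) + a (s + 3*j + 1) + a (s + 3*j + 2)"
  shows "2 * k \<le> sum a {s..<s + 3*k}"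
  using assms
proof (induction k)
  case 0
  then show ?case by simp
next
  case (Suc k)
  have "sum a {s..<s + 3 * Suc k}
      = sum a {s..<s + 3*k} + (a (s + 3*k) + a (s + 3*k + 1) + a (s + 3*k + 2))"
    by (simp add: numeral_3_eq_3)
  moreover have "2 * k \<le> sum a {s..<s + 3*k}"
    using Suc by simp
  ultimately show ?case
    using Suc.prems[of k] by simp
qed

text \<open>This isolates the counting from the graph: \<open>a\<close> stands for layer sizes
  padded with empty layers at \<open>0\<close> and \<open>n + 1\<close>, and \<open>isolated\<close>
  records what happens when layer \<open>2\<close> has no neighbours in the set.\<close>

lemma layer_sum_ge:
  fixes a :: "nat \<Rightarrow> nat"
  assumes "a 0 = 0" and "a (Suc n) = 0"
    and triple: "\<And>i. i < n \<Longrightarrow> 2 \<le> a i + a (i + 1) + a (i + 2)"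
    and isolated: "a 1 = 0 \<Longrightarrow> a 3 = 0 \<Longrightarrow> 3 \<le> a 2"
    and "k > 0" and n: "n = 3 * k \<or> n = 3 * k + 1 \<or> n = 3 * k + 2"
  shows "(if n = 3 * k then 2 * k + 1 else 2 * k + 2) \<le> sum a {1..n}"
proof -
  have tail: "2 * t \<le> sum a {s..<s + 3*t}" if "s + 3*t \<le> n + 2" for s t
    using that by (intro sum_triples_ge triple) auto
  have total: "sum a {0..<n+2} = sum a {1..n}"
    using assms(1,2)
    by (simp add: sum.atLeast_Suc_lessThan flip: atLeastLessThanSuc_atLeastAtMost)
  show ?thesis
  proof (cases "n = 3 * k")
    case False
    \<comment> \<open>As \<open>n > 3 * k\<close>, there is room for \<open>k + 1\<close> disjoint
      triples among the \<open>n + 2\<close> padded layers.\<close>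
    have "sum a {0..<0 + 3*(k+1)} \<le> sum a {0..<n+2}"
      using n False by (intro sum_mono2) auto
    then show ?thesis
      using tail[of 0 "k+1"] total n False by auto
  next
    case True
    \<comment> \<open>Here \<open>n + 2 = 3 * k + 2\<close>, so two layers escape the triples. Both
      are left out on the left here; \<open>split3\<close> leaves out one more triple on the left
      and layer \<open>n + 1\<close> on the right.\<close>
    have split1: "sum a {0..<n+2} = a 0 + a 1 + sum a {2..<2+3*k}"
      using True by (simp add: sum.atLeast_Suc_lessThan numeral_2_eq_2)
    obtain l where k: "k = Suc l"
      using \<open>k > 0\<close> gr0_conv_Suc by auto
    have split3: "sum a {0..<n+2} = a 0 + a 1 + a 2 + a 3 + sum a {4..<4+3*l}"
    proof -
      have "n + 2 = Suc (Suc n)" "Suc n = 4 + 3*l"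
        using True k by simp_all
      then have "sum a {0..<n+2} = sum a {0..<4+3*l} + a (Suc n)"
        by (metis sum.atLeast0_lessThan_Suc)
      moreover have "sum a {0..<4} = a 0 + a 1 + a 2 + a 3"
        by (simp add: eval_nat_numeral)
      moreover have "sum a {0..<4} + sum a {4..<4+3*l} = sum a {0..<4+3*l}"
        by (rule sum.atLeastLessThan_concat) simp_all
      ultimately show ?thesis
        using assms(2) by linarith
    qed
    have "2 * k \<le> sum a {2..<2+3*k}" "2 * l \<le> sum a {4..<4+3*l}"
      using tail[of 2 k] tail[of 4 l] True k by auto
    moreover have "2 \<le> a 0 + a 1 + a 2"
      using triple[of 0] True \<open>k > 0\<close> by (simp add: numeral_2_eq_2)
    \<comment> \<open>Each alternative raises the total above \<open>2 * k\<close>: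
      \<open>1 \<le> a 1\<close> via \<open>split1\<close>, the other two via \<open>split3\<close>,
      where the first four layers then contribute at least \<open>3\<close>.\<close>
    moreover have "1 \<le> a 1 \<or> 1 \<le> a 3 \<or> 3 \<le> a 2"
      using isolated by linarith
    ultimately have "2 * k + 1 \<le> sum a {1..n}"
      using split1 split3 total k by linarith
    then show ?thesis
      using True by simp
  qed
qed

section \<open>Lower bound for dominating sets\<close>

text \<open>A vertex outside \<open>D\<close> has a neighbour in \<open>D\<close>, which lies one
  layer away and differs in the second coordinate. Layers are images of \<open>D\<close>, so the end
  layers need no case split: the images at \<open>0\<close> and \<open>n + 1\<close> are
  empty.\<close>

lemma dominating_set_path_completeD:
  assumes "dominating_set (direct_product (path_graph n) (complete_graph m)) D"
    and "1 \<le> i" "i \<le> n" "h \<in> {1..m}" "h \<notin> D `` {i}"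
  shows "\<exists>c. c \<noteq> h \<and> (c \<in> D `` {i - 1} \<or> c \<in> D `` {i + 1})"
proof -
  have "(i, h) \<in> verts (direct_product (path_graph n) (complete_graph m)) - D"
    using assms(2-) by (auto simp: direct_product_def path_graph_def complete_graph_def)
  then obtain p c where "(p, c) \<in> D"
    "adjacent (direct_product (path_graph n) (complete_graph m)) (i, h) (p, c)"
    using assms(1) unfolding dominating_set_def by (metis surj_pair)
  then show ?thesis
    by (auto simp: adjacent_direct_product adjacent_path_graph adjacent_complete_graph)
qed

lemma dominating_set_path_complete_card_ge:
  assumes D: "dominating_set (direct_product (path_graph n) (complete_graph m)) D"
    and "m \<ge> 3" and "k > 0" and n: "n = 3 * k \<or> n = 3 * k + 1 \<or> n = 3 * k + 2"
  shows "(if n = 3 * k then 2 * k + 1 else 2 * k + 2) \<le> card D"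
proof -
  define a where "a i = card (D `` {i})" for i
  have sub: "D \<subseteq> {1..n} \<times> {1..m}"
    using D by (auto simp: dominating_set_def direct_product_def path_graph_def complete_graph_def)
  have layer: "D `` {i} \<subseteq> {1..m}" for i
    using sub by auto
  have fin: "finite (D `` {i})" for i
    using layer finite_subset by blast
  have full: "3 \<le> a i" if "1 \<le> i" "i \<le> n" "D `` {i-1} = {}" "D `` {i+1} = {}" for i
  proof -
    have "{1..m} \<subseteq> D `` {i}"
      using dominating_set_path_completeD[OF D that(1,2)] that(3,4) by blast
    then show ?thesis
      unfolding a_def using card_mono[OF fin, of "{1..m}" i] \<open>m \<ge> 3\<close> by simp
  qed
  have triple: "2 \<le> a i + a (i+1) + a (i+2)" if "i < n" for i
  proof (rule ccontr)
    assume less: "\<not> 2 \<le> a i + a (i+1) + a (i+2)"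
    show False
    proof (cases "D `` {i} = {} \<and> D `` {i+2} = {}")
      case True
      then show False
        using full[of "i+1"] less that by (simp add: numeral_2_eq_2)
    next
      case False
      then have "a i + a (i+2) \<noteq> 0"
        unfolding a_def using fin by simp
      then have "a (i+1) = 0" and "a i + a (i+2) = 1"
        using less by linarith+
      moreover have "card (D `` {i} \<union> D `` {i+2}) \<le> a i + a (i+2)"
        unfolding a_def by (rule card_Un_le)
      ultimately have mid: "D `` {i+1} = {}" and le: "card (D `` {i} \<union> D `` {i+2}) \<le> Suc 0"
        using fin[of "i+1"] unfolding a_def by (metis card_0_eq, metis One_nat_def)
      \<comment> \<open>The layers around \<open>i + 1\<close> contain one vertex in all, with
        second coordinate \<open>h\<close>; the vertex \<open>(i + 1, h)\<close> is then neither in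
        \<open>D\<close> nor dominated.\<close>
      obtain h where h: "h \<in> D `` {i} \<union> D `` {i+2}"
        using False by blast
      then have "D `` {i} \<union> D `` {i+2} \<subseteq> {h}"
        using le fin[of i] fin[of "i+2"] card_le_Suc0_iff_eq[of "D `` {i} \<union> D `` {i+2}"]
        by blast
      moreover have "h \<in> {1..m}"
        using h layer by blast
      moreover have "i + 1 - 1 = i" "i + 1 + 1 = i + 2" "1 \<le> i + 1" "i + 1 \<le> n"
        using that by simp_all
      ultimately show False
        using dominating_set_path_completeD[OF D, of "i+1" h] mid
        by (metis Un_iff empty_iff singletonD subsetD)
    qed
  qed
  have "Sigma {1..n} (\<lambda>i. D `` {i}) = D"
    using sub by auto
  moreover have "card (Sigma {1..n} (\<lambda>i. D `` {i})) = sum a {1..n}"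
    using fin by (simp add: a_def)
  ultimately have "card D = sum a {1..n}"
    by (rule subst)
  moreover have "a 0 = 0" "a (Suc n) = 0"
  proof -
    have "D `` {0} = {}" "D `` {Suc n} = {}"
      using sub by auto
    then show "a 0 = 0" "a (Suc n) = 0"
      by (simp_all add: a_def)
  qed
  moreover have "3 \<le> a 2" if "a 1 = 0" "a 3 = 0"
  proof -
    have "2 \<le> n"
      using n \<open>k > 0\<close> by linarith
    then show ?thesis
      using full[of 2] that fin by (simp add: a_def)
  qed
  ultimately show ?thesis
    using layer_sum_ge[of a n k] triple \<open>k > 0\<close> n by simp
qed

section \<open>Construction of optimal dominating sets\<close>

text \<open>Two distinct coordinates in neighbouring layers dominate all of layer \<open>i\<close>,
  since each \<open>h\<close> differs from one of them. A single neighbour with coordinate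
  \<open>c\<close> misses only \<open>(i, c)\<close>, which is harmless if that vertex is in
  \<open>D\<close>.\<close>

lemma dominating_set_path_completeI:
  assumes "D \<subseteq> {1..n} \<times> {1..m}"
    and "\<And>i. 1 \<le> i \<Longrightarrow> i \<le> n \<Longrightarrow>
      \<exists>p c q d. (p, c) \<in> D \<and> (q, d) \<in> D \<and> (p = i + 1 \<or> i = p + 1) \<and>
        ((q = i + 1 \<or> i = q + 1) \<and> c \<noteq> d \<or> q = i \<and> c = d)"
  shows "dominating_set (direct_product (path_graph n) (complete_graph m)) D"
  unfolding dominating_set_def
proof (intro conjI ballI)
  show "D \<subseteq> verts (direct_product (path_graph n) (complete_graph m))"
    using assms(1) by (simp add: direct_product_def path_graph_def complete_graph_def)
next
  fix v assume v: "v \<in> verts (direct_product (path_graph n) (complete_graph m)) - D"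
  obtain i h where ih: "v = (i, h)"
    by (cases v)
  have range: "1 \<le> i" "i \<le> n" "h \<in> {1..m}" "(i, h) \<notin> D"
    using v ih by (auto simp: direct_product_def path_graph_def complete_graph_def)
  obtain p c q d where pq: "(p, c) \<in> D" "(q, d) \<in> D" "p = i + 1 \<or> i = p + 1"
      "(q = i + 1 \<or> i = q + 1) \<and> c \<noteq> d \<or> q = i \<and> c = d"
    using assms(2) range by metis
  then have "\<exists>u\<in>{(p, c), (q, d)}. (fst u = i + 1 \<or> i = fst u + 1) \<and> snd u \<noteq> h"
    using range by auto
  then obtain r e where "(r, e) \<in> D" "r = i + 1 \<or> i = r + 1" "e \<noteq> h"
    using pq by auto
  then show "\<exists>u\<in>D. adjacent (direct_product (path_graph n) (complete_graph m)) v u"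
    using range assms(1) unfolding ih
    by (intro bexI[of _ "(r, e)"])
      (auto simp: adjacent_direct_product adjacent_path_graph adjacent_complete_graph)
qed

text \<open>Consecutive pairs must differ in the second coordinate, so alternating between
  \<open>1\<close> and \<open>2\<close> suffices.\<close>

definition paired_layers :: "nat \<Rightarrow> (nat \<times> nat) set" where
  "paired_layers k = (\<lambda>j. (3*j + 1, 1 + j mod 2)) ` {..<k} \<union> (\<lambda>j. (3*j + 2, 1 + j mod 2)) ` {..<k}"

lemma finite_paired_layers: "finite (paired_layers k)"
  by (simp add: paired_layers_def)

lemma card_paired_layers_le: "card (paired_layers k) \<le> 2 * k"
proof -
  have "card (paired_layers k) \<le> card {..<k} + card {..<k}"
    unfolding paired_layers_def
    by (rule order_trans[OF card_Un_le]) (intro add_mono card_image_le finite_lessThan)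
  then show ?thesis by simp
qed

lemma paired_layers_mem:
  assumes "j < k"
  shows "(3*j + 1, 1 + j mod 2) \<in> paired_layers k" "(3*j + 2, 1 + j mod 2) \<in> paired_layers k"
  using assms by (auto simp: paired_layers_def)

text \<open>For \<open>k > 0\<close> the last occupied layer is \<open>3 * k - 1\<close>.\<close>

lemma paired_layers_subset:
  assumes "3 * k \<le> n + 1" and "2 \<le> m"
  shows "paired_layers k \<subseteq> {1..n} \<times> {1..m}"
  using assms by (auto simp: paired_layers_def)

text \<open>Layer \<open>3*j\<close> lies between two pairs with different coordinates, and the two
  layers of a pair serve each other. Passing to a superset \<open>D\<close> lets vertices be added
  at the right end.\<close>

lemma paired_layers_dominate:
  assumes "paired_layers k \<subseteq> D" and "1 \<le> i" and "i < 3 * k"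
  shows "\<exists>p c q d. (p, c) \<in> D \<and> (q, d) \<in> D \<and> (p = i + 1 \<or> i = p + 1) \<and>
        ((q = i + 1 \<or> i = q + 1) \<and> c \<noteq> d \<or> q = i \<and> c = d)"
proof -
  define j where "j = i div 3"
  have jk: "j < k"
    using assms(3) unfolding j_def by auto
  consider "i = 3*j" | "i = 3*j + 1" | "i = 3*j + 2"
    unfolding j_def by linarith
  then show ?thesis
  proof cases
    case 1
    then obtain l where l: "j = Suc l"
      using assms(2) by (cases j) auto
    have "(3*l + 2, 1 + l mod 2) \<in> D" "(3*j + 1, 1 + j mod 2) \<in> D"
      using paired_layers_mem[of l k] paired_layers_mem[of j k] jk l assms(1) by auto
    moreover have "1 + l mod 2 \<noteq> 1 + j mod 2"
      unfolding l by presburger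
    moreover have "i = (3*l + 2) + 1" "3*j + 1 = i + 1"
      using 1 l by auto
    ultimately show ?thesis by blast
  next
    case 2
    then have "(i, 1 + j mod 2) \<in> D" "(i + 1, 1 + j mod 2) \<in> D"
      using paired_layers_mem[OF jk] assms(1) by auto
    then show ?thesis by blast
  next
    case 3
    then have "(i, 1 + j mod 2) \<in> D" "(3*j + 1, 1 + j mod 2) \<in> D" "i = (3*j + 1) + 1"
      using paired_layers_mem[OF jk] assms(1) by auto
    then show ?thesis by blast
  qed
qed

text \<open>An upper bound on \<open>card D\<close> is enough, as the lower bound turns it into an
  equality.\<close>

lemma ex_dominating_set_path_complete:
  assumes "m \<ge> 3" and "k > 0" and n: "n = 3 * k \<or> n = 3 * k + 1 \<or> n = 3 * k + 2"
  shows "\<exists>D. dominating_set (direct_product (path_graph n) (complete_graph m)) D \<and> finite D \<and>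
    card D \<le> (if n = 3 * k then 2 * k + 1 else 2 * k + 2)"
proof -
  obtain l where l: "k = Suc l"
    using \<open>k > 0\<close> gr0_conv_Suc by auto
  have last: "(3*l + 2, 1 + l mod 2) \<in> paired_layers k" and "3*k = 3*l + 2 + 1"
    using paired_layers_mem[of l k] l by auto
  from n consider "n = 3 * k" | "n = 3 * k + 1" | "n = 3 * k + 2"
    by blast
  then show ?thesis
  proof cases
    case 1
    \<comment> \<open>No pair follows layer \<open>3*k\<close>, so it receives a vertex with the
      coordinate of the last pair, whose second vertex dominates the rest of the layer.\<close>
    let ?D = "insert (3*k, 1 + l mod 2) (paired_layers k)"
    have "dominating_set (direct_product (path_graph n) (complete_graph m)) ?D"
    proof (rule dominating_set_path_completeI)
      show "?D \<subseteq> {1..n} \<times> {1..m}"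
        using paired_layers_subset[of k n m] 1 assms by auto
    next
      fix i assume i: "1 \<le> i" "i \<le> n"
      then consider "i < 3*k" | "i = 3*k"
        using 1 by linarith
      then show "\<exists>p c q d. (p, c) \<in> ?D \<and> (q, d) \<in> ?D \<and> (p = i + 1 \<or> i = p + 1) \<and>
        ((q = i + 1 \<or> i = q + 1) \<and> c \<noteq> d \<or> q = i \<and> c = d)"
      proof cases
        case 1
        then show ?thesis
          using i by (intro paired_layers_dominate[of k]) auto
      next
        case 2
        then show ?thesis
          using last \<open>3*k = 3*l + 2 + 1\<close> by blast
      qed
    qed
    moreover have "card ?D \<le> 2 * k + 1"
      using card_paired_layers_le[of k] finite_paired_layers[of k] by (simp add: card_insert_if)
    ultimately show ?thesis
      using 1 finite_paired_layers by (intro exI[of _ ?D]) auto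
  next
    case 2
    \<comment> \<open>Layer \<open>3*k + 2\<close> does not exist, so the next pair is shifted one
      layer to the left.\<close>
    let ?D = "{(3*k, 1 + k mod 2), (3*k + 1, 1 + k mod 2)} \<union> paired_layers k"
    have "dominating_set (direct_product (path_graph n) (complete_graph m)) ?D"
    proof (rule dominating_set_path_completeI)
      show "?D \<subseteq> {1..n} \<times> {1..m}"
        using paired_layers_subset[of k n m] 2 assms by auto
    next
      fix i assume i: "1 \<le> i" "i \<le> n"
      then consider "i < 3*k" | "i = 3*k" | "i = 3*k + 1"
        using 2 by linarith
      then show "\<exists>p c q d. (p, c) \<in> ?D \<and> (q, d) \<in> ?D \<and> (p = i + 1 \<or> i = p + 1) \<and>
        ((q = i + 1 \<or> i = q + 1) \<and> c \<noteq> d \<or> q = i \<and> c = d)"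
      proof cases
        case 1
        then show ?thesis
          using i by (intro paired_layers_dominate[of k]) auto
      qed blast+
    qed
    moreover have "card ?D \<le> 2 * k + 2"
      using card_paired_layers_le[of k] finite_paired_layers[of k] by (simp add: card_insert_if)
    ultimately show ?thesis
      using 2 finite_paired_layers by (intro exI[of _ ?D]) auto
  next
    case 3
    \<comment> \<open>Now the next pair fits, ending exactly in layer \<open>n\<close>.\<close>
    have "dominating_set (direct_product (path_graph n) (complete_graph m)) (paired_layers (k+1))"
      using paired_layers_subset[of "k+1" n m] paired_layers_dominate[of "k+1"] 3 assms
      by (intro dominating_set_path_completeI) auto
    then show ?thesis
      using 3 finite_paired_layers[of "k+1"] card_paired_layers_le[of "k+1"]
      by (intro exI[of _ "paired_layers (k+1)"]) auto
  qed
qed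

theorem theorem4p5:
  fixes m n k :: nat
  assumes "m \<ge> 3" and "n \<ge> 3" and "k > 0"
    and "n = 3 * k \<or> n = 3 * k + 1 \<or> n = 3 * k + 2"
  shows "domination_number (direct_product (path_graph n) (complete_graph m)) =
           (if n = 3 * k then 2 * k + 1 else 2 * k + 2)"
proof -
  obtain D where D: "dominating_set (direct_product (path_graph n) (complete_graph m)) D" "finite D"
    "card D \<le> (if n = 3 * k then 2 * k + 1 else 2 * k + 2)"
    using ex_dominating_set_path_complete assms by blast
  have "card D = (if n = 3 * k then 2 * k + 1 else 2 * k + 2)"
    using dominating_set_path_complete_card_ge[OF D(1) assms(1,3,4)] by (rule le_antisym[OF D(3)])
  then show ?thesis
    unfolding domination_number_def
    using D dominating_set_path_complete_card_ge[OF _ assms(1,3,4)]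
    by (intro Least_equality) blast+
qed

end
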